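(* Let $p\geq 1$ be an integer, $q\in(0,1)$, $\mu>-1$ and $-1\leq B<A\leq 1$. Let $f\in\mathcal{S}_p^{\ast}(q,\mu,A,B)$ be given by $f(z)=z^p+\sum_{n=1}^{\infty}a_{n+p}z^{n+p}$. Then for every $\lambda\in\mathbb{C}$, $$|a_{p+2}-\lambda a_{p+1}^2|\leq\frac{(A-B)\psi_2}{\Lambda_{p+2}}\max\{1,|\upsilon|\},$$ where $$\upsilon=\bigl(B-(A-B)\psi_1\bigr)+\frac{\Lambda_{p+2}\psi_1^2}{\Lambda_{p+1}^2\psi_2}(A-B)\lambda .$$
   Context: Let $\mathbb{D}=\{z\in\mathbb{C}:|z|<1\}$. For an integer $p\ge 1$, $\mathfrak{A}_p$ is the set of functions analytic in $\mathbb{D}$ of the form $f(z)=z^p+\sum_{n=1}^\infty a_{n+p}z^{n+p}$. For $q\in(0,1)$ and real $x$, $[x,q]=\frac{1-q^x}{1-q}$; for integers $n\ge1$, $[n,q]!=[1,q][2,q]\cdots[n,q]$ and $[0,q]!=1$; for $x>0$, $[x,q]_0=1$ and $[x,q]_n=[x,q][x+1,q]\cdots[x+n-1,q]$ for $n\ge 1$. For $\mu>-1$ put $\Lambda_{n+p}=\frac{[\mu+1,q]_{n+p}}{[n+p,q]!}$, and for $n\ge1$ put $\psi_n=\frac{[p,q]}{[n+p,q]-[p,q]}$. The $q$-derivative is $\partial_q f(z)=\frac{f(z)-f(qz)}{z(1-q)}$ for $z\ne0$, so that it acts on power series termwise by $\partial_q z^m=[m,q]z^{m-1}$. The operator $\mathcal{L}_q^{\mu+p-1}:\mathfrak{A}_p\to\mathfrak{A}_p$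 is $\mathcal{L}_q^{\mu+p-1}f(z)=z^p+\sum_{n=1}^\infty \Lambda_{n+p}a_{n+p}z^{n+p}$. For $g,h$ analytic in $\mathbb{D}$, $g\prec h$ (subordination) means there is an analytic $w$ on $\mathbb{D}$ with $w(0)=0$, $|w(z)|<1$ and $g(z)=h(w(z))$ for all $z\in\mathbb{D}$. For $q\in(0,1)$, $\mu>-1$ and $-1\le B<A\le1$, the class $\mathcal{S}_p^{\ast}(q,\mu,A,B)$ consists of all $f\in\mathfrak{A}_p$ such that $$\frac{z\,\partial_q\mathcal{L}_q^{\mu+p-1}f(z)}{[p,q]\,\mathcal{L}_q^{\mu+p-1}f(z)}\prec\frac{1+Az}{1+Bz},$$ where the quotient on the left is understood to take the value $1$ at $z=0$. *)

theory Defs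
  imports "HOL-Complex_Analysis.Complex_Analysis"
begin

text \<open>Functions on the unit disc are total functions on \<open>complex\<close>; their values outside
  \<open>ball 0 1\<close> play no role.\<close>

definition q_number :: "real \<Rightarrow> real \<Rightarrow> real" where
  "q_number q x = (1 - q powr x) / (1 - q)"

definition q_fact :: "real \<Rightarrow> nat \<Rightarrow> real" where
  "q_fact q n = (\<Prod>k=1..n. q_number q (real k))"

definition q_pochhammer :: "real \<Rightarrow> real \<Rightarrow> nat \<Rightarrow> real" where
  "q_pochhammer q x n = (\<Prod>k<n. q_number q (x + real k))"

text \<open>The index \<open>m\<close> is the full exponent, i.e. \<open>m = n + p\<close>.\<close>

definition Lambda :: "real \<Rightarrow> real \<Rightarrow> nat \<Rightarrow> real" where
  "Lambda q \<mu> m = q_pochhammer q (\<mu> + 1) m / q_fact q m"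

definition psi :: "real \<Rightarrow> nat \<Rightarrow> nat \<Rightarrow> real" where
  "psi q p n = q_number q (real p) / (q_number q (real (n + p)) - q_number q (real p))"

definition has_p_valent_expansion :: "nat \<Rightarrow> (complex \<Rightarrow> complex) \<Rightarrow> (nat \<Rightarrow> complex) \<Rightarrow> bool" where
  "has_p_valent_expansion p f a \<longleftrightarrow>
     (\<forall>z\<in>ball 0 1. (\<lambda>n. a (Suc n + p) * z ^ (Suc n + p)) sums (f z - z ^ p))"

definition class_A :: "nat \<Rightarrow> (complex \<Rightarrow> complex) set" where
  "class_A p = {f. f holomorphic_on ball 0 1 \<and> (\<exists>a. has_p_valent_expansion p f a)}"

text \<open>The value at \<open>0\<close> is the one given by the termwise action on power series, as
  \<open>q_number q 1 = 1\<close>.\<close>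

definition q_deriv :: "real \<Rightarrow> (complex \<Rightarrow> complex) \<Rightarrow> complex \<Rightarrow> complex" where
  "q_deriv q f z =
     (if z = 0 then deriv f 0 else (f z - f (of_real q * z)) / (z * (1 - of_real q)))"

definition L_op :: "real \<Rightarrow> real \<Rightarrow> nat \<Rightarrow> (complex \<Rightarrow> complex) \<Rightarrow> complex \<Rightarrow> complex" where
  "L_op q \<mu> p f z =
     z ^ p + (\<Sum>n. of_real (Lambda q \<mu> (Suc n + p)) * fps_nth (fps_expansion f 0) (Suc n + p)
                     * z ^ (Suc n + p))"

definition subordinate :: "(complex \<Rightarrow> complex) \<Rightarrow> (complex \<Rightarrow> complex) \<Rightarrow> bool"
    (infix "\<prec>\<^sub>D" 50) where
  "g \<prec>\<^sub>D h \<longleftrightarrow>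
     g holomorphic_on ball 0 1 \<and> h holomorphic_on ball 0 1 \<and>
     (\<exists>w. w holomorphic_on ball 0 1 \<and> w 0 = 0 \<and>
          (\<forall>z\<in>ball 0 1. norm (w z) < 1 \<and> g z = h (w z)))"

text \<open>If \<open>F = L_op q \<mu> p f\<close> vanishes at some \<open>z \<noteq> 0\<close> in the disc, HOL division makes the quotient
  \<open>0\<close>.  No such \<open>f\<close> is admitted, because for \<open>-1 \<le> B < A \<le> 1\<close> the function
  \<open>(1 + A w) / (1 + B w)\<close> has no zero in the disc.  None is lost either, if the singularity
  were filled in analytically instead: the relation would give \<open>F (q z) = 0\<close>, and by iteration
  zeros of \<open>F\<close> accumulating at \<open>0\<close>.\<close>

definition class_S ::
    "nat \<Rightarrow> real \<Rightarrow> real \<Rightarrow> real \<Rightarrow> real \<Rightarrow> (complex \<Rightarrow> complex) set" where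
  "class_S p q \<mu> A B =
     {f \<in> class_A p.
        (\<lambda>z. if z = 0 then 1
              else z * q_deriv q (L_op q \<mu> p f) z
                     / (of_real (q_number q (real p)) * L_op q \<mu> p f z))
        \<prec>\<^sub>D (\<lambda>z. (1 + of_real A * z) / (1 + of_real B * z))}"

end

theory Submission
  imports Defs
begin

text \<open>
  Put \<open>F = L_op q \<mu> p f\<close> and let \<open>w = w\<^sub>1 z + w\<^sub>2 z\<^sup>2 + \<dots>\<close> be the Schwarz function that
  realises the subordination. Clearing denominators gives
  \<open>(1 + B w) z \<partial>\<^sub>q F = (1 + A w) [p,q] F\<close>. Write \<open>F = z\<^sup>p (1 + b\<^sub>1 z + b\<^sub>2 z\<^sup>2 + \<dots>)\<close>; the operator
  \<open>z \<partial>\<^sub>q\<close> multiplies the coefficient of \<open>z\<^bsup>n+p\<^esup>\<close> by \<open>[n+p,q] = [p,q] (1 + 1/\<psi>\<^sub>n)\<close>, so comparison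
  of the first two nontrivial coefficients yields
  \<open>b\<^sub>1 = (A - B) \<psi>\<^sub>1 w\<^sub>1\<close> and \<open>b\<^sub>2 = (A - B) \<psi>\<^sub>2 (w\<^sub>2 - (B - (A - B) \<psi>\<^sub>1) w\<^sub>1\<^sup>2)\<close>
  (lemma \<open>subordination_coefficients\<close>). Since \<open>b\<^sub>n = \<Lambda>\<^bsub>n+p\<^esub> a\<^bsub>n+p\<^esub>\<close>, the functional in question equals
  \<open>(A - B) \<psi>\<^sub>2 / \<Lambda>\<^bsub>p+2\<^esub> \<cdot> (w\<^sub>2 - \<upsilon> w\<^sub>1\<^sup>2)\<close>.

  The bound then follows from \<open>\<bar>w\<^sub>2\<bar> \<le> 1 - \<bar>w\<^sub>1\<bar>\<^sup>2\<close> (lemma \<open>schwarz_function_coeff_2\<close>), which makes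
  \<open>\<bar>w\<^sub>2\<bar> + \<bar>\<upsilon>\<bar> \<bar>w\<^sub>1\<bar>\<^sup>2\<close> at most a convex combination of \<open>1\<close> and \<open>\<bar>\<upsilon>\<bar>\<close>. That inequality is the
  Schwarz--Pick lemma at the origin for \<open>w(z)/z\<close>.

  All coefficient comparisons concern germs at \<open>0\<close>, so it is enough that the series defining \<open>F\<close>
  converges in some neighbourhood of \<open>0\<close>; the crude bound \<open>\<Lambda>\<^sub>m \<le> (1 - q)\<^bsup>-m\<^esup>\<close> gives this.
\<close>

section \<open>The second coefficient of a Schwarz function\<close>

lemma fps_eq_if_eventually_eq:
  fixes f g :: "complex \<Rightarrow> complex"
  assumes "f has_fps_expansion F" "g has_fps_expansion G" "eventually (\<lambda>z. f z = g z) (nhds 0)"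
  shows "F = G"
proof (rule fps_expansion_unique_complex)
  show "f has_fps_expansion G"
    using assms(2) has_fps_expansion_cong[OF assms(3) refl] by simp
qed (rule assms(1))

lemma eventually_nhds_ball:
  fixes r :: real
  assumes "0 < r" "\<And>z::'a::real_normed_vector. norm z < r \<Longrightarrow> P z"
  shows "eventually P (nhds 0)"
  using assms by (auto simp: eventually_nhds_metric dist_norm)

text \<open>
  Composing with the disc automorphism that moves \<open>g 0\<close> to the origin reduces the claim to the
  Schwarz lemma; the automorphism has derivative \<open>1 / (1 - \<bar>g 0\<bar>\<^sup>2)\<close> at \<open>g 0\<close>.
\<close>

lemma schwarz_pick_at_0:
  fixes g :: "complex \<Rightarrow> complex"
  assumes hol: "g holomorphic_on ball 0 1" and lt: "\<And>z. norm z < 1 \<Longrightarrow> norm (g z) < 1"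
  shows "norm (deriv g 0) \<le> 1 - (norm (g 0))\<^sup>2"
proof -
  define c where "c = g 0"
  have c: "norm c < 1" using lt[of 0] by (simp add: c_def)
  define h where "h = (\<lambda>z. Moebius_function 0 c (g z))"
  have "Moebius_function 0 c \<circ> g holomorphic_on ball 0 1"
    using lt by (intro holomorphic_on_compose_gen[OF hol Moebius_function_holomorphic[OF c]]) auto
  hence h_hol: "h holomorphic_on ball 0 1"
    by (simp add: h_def o_def)
  have h0: "h 0 = 0"
    by (simp add: h_def c_def Moebius_function_def)
  have h_lt: "norm (h z) < 1" if "norm z < 1" for z
    unfolding h_def by (rule Moebius_function_norm_lt_1[OF c lt[OF that]])
  have pos: "0 < 1 - (norm c)\<^sup>2"
    using c by (simp add: power_less_one_iff)
  have cc: "1 - cnj c * c = of_real (1 - (norm c)\<^sup>2)"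
    by (simp add: complex_norm_square mult.commute del: of_real_power)
  have nz: "1 - cnj c * c \<noteq> 0"
    unfolding cc using pos by (metis less_irrefl of_real_eq_0_iff)
  have dg: "(g has_field_derivative deriv g 0) (at 0)"
    using hol by (intro holomorphic_derivI[of _ "ball 0 1"]) auto
  have "(h has_field_derivative deriv g 0 / (1 - cnj c * c)) (at 0)"
  proof -
    have "((\<lambda>z. g z - c) has_field_derivative deriv g 0) (at 0)"
      and "((\<lambda>z. 1 - cnj c * g z) has_field_derivative - (cnj c * deriv g 0)) (at 0)"
      by (auto intro!: derivative_eq_intros dg)
    from DERIV_divide[OF this] show ?thesis
      using nz by (simp add: h_def Moebius_function_simple c_def)
  qed
  hence "deriv h 0 = deriv g 0 / of_real (1 - (norm c)\<^sup>2)"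
    unfolding cc by (rule DERIV_imp_deriv)
  moreover have "norm (deriv h 0) \<le> 1"
    using Schwarz_Lemma(2)[OF h_hol h0 h_lt, of 0] by simp
  ultimately have "norm (deriv g 0) / (1 - (norm c)\<^sup>2) \<le> 1"
    using pos by (simp add: norm_divide del: of_real_diff of_real_power)
  thus ?thesis
    using pos by (simp add: c_def)
qed

text \<open>
  The quotient \<open>w(z)/z\<close> has value \<open>w\<^sub>1\<close> and derivative \<open>w\<^sub>2\<close> at the origin. Either it maps the disc
  into itself, and the Schwarz--Pick inequality applies, or \<open>w\<close> is a rotation, with \<open>\<bar>w\<^sub>1\<bar> = 1\<close> and
  \<open>w\<^sub>2 = 0\<close>.
\<close>

lemma schwarz_function_coeff_2:
  fixes w :: "complex \<Rightarrow> complex"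
  assumes hol: "w holomorphic_on ball 0 1" and w0: "w 0 = 0"
    and lt: "\<And>z. norm z < 1 \<Longrightarrow> norm (w z) < 1"
    and W: "w has_fps_expansion W"
  shows "norm (fps_nth W 2) \<le> 1 - (norm (fps_nth W 1))\<^sup>2"
proof -
  have W1: "fps_nth W 1 = deriv w 0"
    using fps_nth_fps_expansion[OF W, of 1] by simp
  have "norm (deriv w 0) \<le> 1"
    using Schwarz_Lemma(2)[OF hol w0 lt, of 0] by simp
  then consider "norm (deriv w 0) = 1" | "norm (deriv w 0) < 1" by linarith
  thus ?thesis
  proof cases
    case 1
    then obtain \<alpha> where \<alpha>: "\<And>z. norm z < 1 \<Longrightarrow> w z = \<alpha> * z"
      using Schwarz_Lemma(3)[OF hol w0 lt, of 0] by auto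
    have "(\<lambda>z. \<alpha> * z) has_fps_expansion fps_const \<alpha> * fps_X"
      by (intro fps_expansion_intros)
    moreover have "eventually (\<lambda>z. w z = \<alpha> * z) (nhds 0)"
      using \<alpha> by (intro eventually_nhds_ball[of 1]) auto
    ultimately have "W = fps_const \<alpha> * fps_X"
      by (rule fps_eq_if_eventually_eq[OF W])
    thus ?thesis using 1 W1 by simp
  next
    case 2
    obtain h where h: "h holomorphic_on ball 0 1" "\<And>z. norm z < 1 \<Longrightarrow> w z = z * h z" "deriv w 0 = h 0"
      using Schwarz3[OF hol w0] by blast
    have h_lt: "norm (h z) < 1" if z: "norm z < 1" for z
    proof (cases "z = 0")
      case True
      thus ?thesis using 2 h(3) by simp
    next
      case False
      have "norm (w z) \<le> norm z"
        using Schwarz_Lemma(1)[OF hol w0 lt z] .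
      moreover have "norm (w z) \<noteq> norm z"
      proof
        assume "norm (w z) = norm z"
        then obtain \<alpha> where \<alpha>: "\<And>z. norm z < 1 \<Longrightarrow> w z = \<alpha> * z" "norm \<alpha> = 1"
          using Schwarz_Lemma(3)[OF hol w0 lt z] False z by blast
        have "eventually (\<lambda>z. w z = \<alpha> * z) (nhds 0)"
          using \<alpha>(1) by (intro eventually_nhds_ball[of 1]) auto
        hence "deriv w 0 = deriv (\<lambda>z. \<alpha> * z) 0"
          by (intro deriv_cong_ev) auto
        with \<alpha>(2) 2 show False by simp
      qed
      ultimately have "norm z * norm (h z) < norm z * 1"
        using h(2)[OF z] by (simp add: norm_mult)
      thus ?thesis by (rule mult_left_less_imp_less) simp
    qed
    define H where "H = fps_expansion h 0"
    have H: "h has_fps_expansion H"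
      unfolding H_def by (rule has_fps_expansion_fps_expansion[OF _ _ h(1)]) auto
    have "(\<lambda>z. z * h z) has_fps_expansion fps_X * H"
      by (intro fps_expansion_intros H)
    moreover have "eventually (\<lambda>z. w z = z * h z) (nhds 0)"
      using h(2) by (intro eventually_nhds_ball[of 1]) auto
    ultimately have "W = fps_X * H"
      by (rule fps_eq_if_eventually_eq[OF W])
    hence "fps_nth W 2 = deriv h 0" "fps_nth W 1 = h 0"
      using fps_nth_fps_expansion[OF H, of 1] fps_nth_fps_expansion[OF H, of 0]
      by (simp_all add: numeral_2_eq_2)
    with schwarz_pick_at_0[OF h(1) h_lt] show ?thesis by simp
  qed
qed

section \<open>q-numbers\<close>

lemma q_number_strict_mono:
  assumes "0 < q" "q < 1" "x < y"
  shows "q_number q x < q_number q y"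
  using assms powr_less_mono'[of q x y] by (simp add: q_number_def divide_strict_right_mono)

lemma q_number_pos:
  assumes "0 < q" "q < 1" "0 < x"
  shows "0 < q_number q x"
  using q_number_strict_mono[OF assms] assms by (simp add: q_number_def)

lemma q_number_le:
  assumes "0 < q" "q < 1"
  shows "q_number q x \<le> 1 / (1 - q)"
  using assms by (simp add: q_number_def divide_right_mono)

lemma q_fact_ge_1:
  assumes "0 < q" "q < 1"
  shows "1 \<le> q_fact q n"
  unfolding q_fact_def
proof (intro prod_ge_1)
  fix k assume "k \<in> {1..n}"
  hence "q powr real k \<le> q powr 1"
    using assms by (intro powr_mono') auto
  thus "1 \<le> q_number q (real k)"
    using assms by (simp add: q_number_def)
qed

lemma Lambda_pos:
  assumes "0 < q" "q < 1" "-1 < \<mu>"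
  shows "0 < Lambda q \<mu> m"
proof -
  have "0 < q_pochhammer q (\<mu> + 1) m"
    unfolding q_pochhammer_def using assms by (intro prod_pos) (auto intro!: q_number_pos)
  thus ?thesis
    using q_fact_ge_1[OF assms(1,2), of m] by (simp add: Lambda_def)
qed

lemma Lambda_le:
  assumes "0 < q" "q < 1" "-1 < \<mu>"
  shows "Lambda q \<mu> m \<le> (1 / (1 - q)) ^ m"
proof -
  have "q_pochhammer q (\<mu> + 1) m \<le> (\<Prod>k<m. 1 / (1 - q))"
    unfolding q_pochhammer_def using assms
    by (intro prod_mono) (auto intro!: q_number_le less_imp_le[OF q_number_pos])
  moreover have "0 \<le> q_pochhammer q (\<mu> + 1) m"
    unfolding q_pochhammer_def using assms
    by (intro prod_nonneg) (auto intro!: less_imp_le[OF q_number_pos])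
  ultimately show ?thesis
    using frac_le[of "(1 / (1 - q)) ^ m" "q_pochhammer q (\<mu> + 1) m" 1 "q_fact q m"]
      q_fact_ge_1[OF assms(1,2), of m] assms
    by (simp add: Lambda_def del: power_one_over)
qed

lemma psi_pos:
  assumes "0 < q" "q < 1" "1 \<le> p" "1 \<le> n"
  shows "0 < psi q p n"
  using q_number_pos[of q "real p"] q_number_strict_mono[of q "real p" "real (n + p)"] assms
  by (simp add: psi_def)

text \<open>
  In this form the multipliers of \<open>z \<partial>\<^sub>q\<close>, divided by \<open>[p,q]\<close>, differ from \<open>1\<close> by \<open>1 / psi\<close>, and this
  difference is all that survives in the comparison of coefficients.
\<close>

lemma q_number_ratio:
  assumes "0 < q" "q < 1" "1 \<le> p" "1 \<le> n"
  shows "q_number q (real (n + p)) = q_number q (real p) * (1 + 1 / psi q p n)"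
  using q_number_pos[of q "real p"] q_number_strict_mono[of q "real p" "real (n + p)"] assms
  by (simp add: psi_def field_simps)

section \<open>Power series of the operators\<close>

lemma p_valent_has_fps_expansion:
  assumes "has_p_valent_expansion p f a"
  shows "f has_fps_expansion fps_X ^ p * Abs_fps (\<lambda>n. if n = 0 then 1 else a (n + p))"
proof (rule has_fps_expansionI)
  let ?F = "fps_X ^ p * Abs_fps (\<lambda>n. if n = 0 then 1 else a (n + p))"
  have "(\<lambda>n. fps_nth ?F n * z ^ n) sums f z" if "z \<in> ball 0 1" for z
  proof -
    have "(\<lambda>n. a (Suc n + p) * z ^ (Suc n + p)) sums (f z - z ^ p)"
      using assms that by (simp add: has_p_valent_expansion_def)
    hence "(\<lambda>n. fps_nth ?F (n + Suc p) * z ^ (n + Suc p)) sums (f z - z ^ p)"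
      by (simp add: fps_X_power_mult_nth)
    moreover have "(\<Sum>n<Suc p. fps_nth ?F n * z ^ n) = z ^ p"
      by (simp add: fps_X_power_mult_nth)
    ultimately show ?thesis
      by (subst (asm) sums_iff_shift) simp
  qed
  thus "eventually (\<lambda>z. (\<lambda>n. fps_nth ?F n * z ^ n) sums f z) (nhds 0)"
    by (intro eventually_nhds_ball[of 1]) auto
qed

text \<open>
  For \<open>\<bar>z\<bar> = (1 - q) r\<close> the factor \<open>(1 - q)\<^sup>m\<close> absorbs \<open>\<Lambda>\<^sub>m\<close>, which leaves a term of the series of \<open>f\<close> at
  the point \<open>r\<close>.
\<close>

lemma L_op_has_fps_expansion:
  assumes q: "0 < q" "q < 1" "-1 < \<mu>" and f: "has_p_valent_expansion p f a"
  shows "L_op q \<mu> p f has_fps_expansion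
    fps_X ^ p * Abs_fps (\<lambda>n. if n = 0 then 1 else of_real (Lambda q \<mu> (n + p)) * a (n + p))"
proof (rule has_fps_expansionI)
  let ?G = "fps_X ^ p * Abs_fps (\<lambda>n. if n = 0 then 1 else of_real (Lambda q \<mu> (n + p)) * a (n + p))"
  have nth: "fps_nth (fps_expansion f 0) (Suc n + p) = a (Suc n + p)" for n
    using fps_expansion_eqI[OF p_valent_has_fps_expansion[OF f]] by (simp add: fps_X_power_mult_nth)
  have "(\<lambda>n. fps_nth ?G n * z ^ n) sums L_op q \<mu> p f z" if "z \<in> ball 0 ((1 - q) / 2)" for z
  proof -
    let ?G' = "fps_X ^ p * Abs_fps (\<lambda>n. if n = 0 then 1 else a (n + p))"
    let ?u = "\<lambda>n. of_real (Lambda q \<mu> (Suc n + p)) * a (Suc n + p) * z ^ (Suc n + p)"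
    define r :: real where "r = norm z / (1 - q)"
    have r: "0 \<le> r" "r < 1 / 2" "norm z = (1 - q) * r"
      using that q by (auto simp: r_def field_simps)
    \<comment> \<open>Convergence at \<open>1/2\<close> upgrades to absolute convergence at \<open>r < 1/2\<close>.\<close>
    have "summable (\<lambda>n. a (Suc n + p) * (of_real (1 / 2)) ^ (Suc n + p))"
      using f[unfolded has_p_valent_expansion_def, rule_format, of "of_real (1 / 2)"]
      by (auto simp: sums_iff)
    hence "summable (\<lambda>n. fps_nth ?G' (n + Suc p) * (of_real (1 / 2)) ^ (n + Suc p))"
      by (simp add: fps_X_power_mult_nth)
    hence "summable (\<lambda>n. fps_nth ?G' n * (of_real (1 / 2)) ^ n)"
      by (subst (asm) summable_iff_shift)
    hence "summable (\<lambda>n. norm (fps_nth ?G' n * (of_real r) ^ n))"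
      by (rule powser_insidea) (use r in simp)
    hence "summable (\<lambda>n. norm (fps_nth ?G' (n + Suc p) * (of_real r) ^ (n + Suc p)))"
      by (rule summable_ignore_initial_segment)
    hence "summable (\<lambda>n. norm (a (Suc n + p) * of_real r ^ (Suc n + p)))"
      by (simp add: fps_X_power_mult_nth)
    hence "summable ?u"
    proof (rule summable_comparison_test')
      fix n
      have "norm (?u n) = Lambda q \<mu> (Suc n + p) * (1 - q) ^ (Suc n + p) * (norm (a (Suc n + p)) * r ^ (Suc n + p))"
        using Lambda_pos[OF q, of "Suc n + p"]
        by (simp only: norm_mult norm_power norm_of_real r(3) power_mult_distrib) simp
      also have "\<dots> \<le> 1 * (norm (a (Suc n + p)) * r ^ (Suc n + p))"
        using Lambda_le[OF q, of "Suc n + p"] q r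
        by (intro mult_right_mono) (auto simp: power_divide field_simps)
      finally show "norm (?u n) \<le> norm (a (Suc n + p) * of_real r ^ (Suc n + p))"
        using r by (simp add: norm_mult norm_power)
    qed
    hence "?u sums (L_op q \<mu> p f z - z ^ p)"
      unfolding L_op_def nth by (simp add: summable_sums)
    hence "(\<lambda>n. fps_nth ?G (n + Suc p) * z ^ (n + Suc p)) sums (L_op q \<mu> p f z - z ^ p)"
      by (simp add: fps_X_power_mult_nth)
    moreover have "(\<Sum>n<Suc p. fps_nth ?G n * z ^ n) = z ^ p"
      by (simp add: fps_X_power_mult_nth)
    ultimately show ?thesis
      by (subst (asm) sums_iff_shift) simp
  qed
  thus "eventually (\<lambda>z. (\<lambda>n. fps_nth ?G n * z ^ n) sums L_op q \<mu> p f z) (nhds 0)"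
    using q by (intro eventually_nhds_ball[of "(1 - q) / 2"]) auto
qed

text \<open>
  This function is \<open>z \<partial>\<^sub>q g\<close>. Keeping the factor \<open>z\<close> removes the case distinction at the origin.
\<close>

lemma q_difference_has_fps_expansion:
  fixes g :: "complex \<Rightarrow> complex"
  assumes "g has_fps_expansion G" "0 < q"
  shows "(\<lambda>z. (g z - g (of_real q * z)) / (1 - of_real q)) has_fps_expansion
    Abs_fps (\<lambda>n. of_real (q_number q (real n)) * fps_nth G n)"
proof -
  have "(g \<circ> (\<lambda>z. of_real q * z)) has_fps_expansion fps_compose G (fps_const (of_real q) * fps_X)"
    by (intro fps_expansion_intros assms) auto
  hence "(\<lambda>z. (g z - g (of_real q * z)) * inverse (1 - of_real q)) has_fps_expansion
      (G - fps_compose G (fps_const (of_real q) * fps_X)) * fps_const (inverse (1 - of_real q))"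
    by (intro fps_expansion_intros assms) (simp add: o_def)
  also have "(G - fps_compose G (fps_const (of_real q) * fps_X)) * fps_const (inverse (1 - of_real q))
      = Abs_fps (\<lambda>n. of_real (q_number q (real n)) * fps_nth G n)"
    using assms(2)
    unfolding fps_compose_linear
    by (intro fps_ext) (simp add: q_number_def powr_realpow divide_inverse algebra_simps)
  finally show ?thesis by (simp add: divide_inverse)
qed

section \<open>The Fekete-Szego bound\<close>

text \<open>
  Here \<open>P\<close> stands for \<open>F / z\<^sup>p\<close> and \<open>Q\<close> for \<open>\<partial>\<^sub>q F / ([p,q] z\<^bsup>p-1\<^esup>)\<close>, with \<open>s n = 1 / \<psi>\<^sub>n\<close> for \<open>n \<ge> 1\<close>. The
  terms of \<open>P\<close> cancel against the \<open>1\<close> in the multiplier \<open>1 + s n\<close>.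
\<close>

lemma subordination_coefficients:
  assumes eq: "(1 + fps_const A * W) * P = (1 + fps_const B * W) * Q"
    and W0: "fps_nth W 0 = 0"
    and P0: "fps_nth P 0 = 1" and Q: "\<And>n. fps_nth Q n = (1 + s n) * fps_nth P n"
    and s0: "s 0 = (0::'a::field)"
  shows "s 1 * fps_nth P 1 = (A - B) * fps_nth W 1"
    and "s 2 * fps_nth P 2 = (A - B) * fps_nth W 2 + (A - B - B * s 1) * fps_nth W 1 * fps_nth P 1"
proof -
  have "fps_nth ((1 + fps_const A * W) * P) n = fps_nth ((1 + fps_const B * W) * Q) n" for n
    by (simp add: eq)
  from this[of 1] this[of 2]
  have 1: "fps_nth P 1 + A * fps_nth W 1 = (1 + s 1) * fps_nth P 1 + B * fps_nth W 1"
    and 2: "fps_nth P 2 + A * fps_nth W 1 * fps_nth P 1 + A * fps_nth W 2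
      = (1 + s 2) * fps_nth P 2 + B * fps_nth W 1 * ((1 + s 1) * fps_nth P 1) + B * fps_nth W 2"
    by (simp_all add: fps_mult_nth Q P0 s0 W0 eval_nat_numeral atLeast0_atMost_Suc algebra_simps)
  from 1 show "s 1 * fps_nth P 1 = (A - B) * fps_nth W 1"
    by (simp add: algebra_simps)
  from 2 show "s 2 * fps_nth P 2 = (A - B) * fps_nth W 2 + (A - B - B * s 1) * fps_nth W 1 * fps_nth P 1"
    by (simp add: algebra_simps)
qed

lemma norm_convex_le_max:
  fixes x y v :: complex
  assumes "norm y \<le> 1 - (norm x)\<^sup>2"
  shows "norm (y - v * x\<^sup>2) \<le> max 1 (norm v)"
proof -
  have "norm (y - v * x\<^sup>2) \<le> norm y + norm v * (norm x)\<^sup>2"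
    using norm_triangle_ineq4[of y "v * x\<^sup>2"] by (simp add: norm_mult norm_power)
  also have "\<dots> \<le> (1 - (norm x)\<^sup>2) * max 1 (norm v) + (norm x)\<^sup>2 * max 1 (norm v)"
  proof (rule add_mono)
    have "0 \<le> 1 - (norm x)\<^sup>2" using assms norm_ge_zero[of y] by linarith
    hence "(1 - (norm x)\<^sup>2) * 1 \<le> (1 - (norm x)\<^sup>2) * max 1 (norm v)"
      by (intro mult_left_mono) auto
    with assms show "norm y \<le> (1 - (norm x)\<^sup>2) * max 1 (norm v)" by (simp only: mult_1_right)
    show "norm v * (norm x)\<^sup>2 \<le> (norm x)\<^sup>2 * max 1 (norm v)"
      by (subst mult.commute, rule mult_left_mono) auto
  qed
  finally show ?thesis by (simp add: algebra_simps)
qed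

text \<open>
  The subordination with denominators cleared. Clearing them is legitimate because
  \<open>(1 + A w) / (1 + B w)\<close> never vanishes on the disc, so neither does \<open>L_op q \<mu> p f\<close> away from the
  origin: division by zero would make the quotient on the left equal to \<open>0\<close>.
\<close>

lemma class_S_schwarz_function:
  assumes AB: "-1 \<le> B" "B < A" "A \<le> 1" and p: "1 \<le> p"
    and f: "f \<in> class_S p q \<mu> A B"
  obtains w where "w holomorphic_on ball 0 1" "w 0 = 0"
    "\<And>z. norm z < 1 \<Longrightarrow> norm (w z) < 1"
    "\<And>z. norm z < 1 \<Longrightarrow> (1 + of_real B * w z) *
        ((L_op q \<mu> p f z - L_op q \<mu> p f (of_real q * z)) / (1 - of_real q))
      = (1 + of_real A * w z) * (of_real (q_number q (real p)) * L_op q \<mu> p f z)"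
proof -
  define F where "F = L_op q \<mu> p f"
  obtain w where w: "w holomorphic_on ball 0 1" "w 0 = 0" "\<And>z. norm z < 1 \<Longrightarrow> norm (w z) < 1"
    and rel: "\<And>z. norm z < 1 \<Longrightarrow> (if z = 0 then 1 else z * q_deriv q F z
        / (of_real (q_number q (real p)) * F z)) = (1 + of_real A * w z) / (1 + of_real B * w z)"
    using f unfolding class_S_def subordinate_def F_def by auto
  have nz: "1 + of_real c * w z \<noteq> 0" if "norm z < 1" "\<bar>c\<bar> \<le> 1" for c :: real and z
  proof
    assume "1 + of_real c * w z = 0"
    hence "norm (of_real c * w z) = 1"
      by (metis add_eq_0_iff norm_minus_cancel norm_one)
    moreover have "\<bar>c\<bar> * norm (w z) \<le> 1 * norm (w z)"
      using that(2) by (rule mult_right_mono) simp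
    ultimately show False using w(3)[OF that(1)] by (simp add: norm_mult)
  qed
  have "(1 + of_real B * w z) * ((F z - F (of_real q * z)) / (1 - of_real q))
      = (1 + of_real A * w z) * (of_real (q_number q (real p)) * F z)" if z: "norm z < 1" for z
  proof (cases "z = 0")
    case True
    thus ?thesis using p by (simp add: F_def L_op_def)
  next
    case False
    have A: "1 + of_real A * w z \<noteq> 0" and B: "1 + of_real B * w z \<noteq> 0"
      using nz[OF z, of A] nz[OF z, of B] AB by auto
    have "z * q_deriv q F z = (F z - F (of_real q * z)) / (1 - of_real q)"
      using False by (simp add: q_deriv_def)
    with rel[OF z] False
    have eq: "(F z - F (of_real q * z)) / (1 - of_real q) / (of_real (q_number q (real p)) * F z)
        = (1 + of_real A * w z) / (1 + of_real B * w z)"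
      by simp
    hence "of_real (q_number q (real p)) * F z \<noteq> 0"
      using A B by auto
    with eq B show ?thesis
      by (metis frac_eq_eq mult.commute)
  qed
  with w show thesis by (intro that[of w]) (auto simp: F_def)
qed

theorem theorem3p4:
  fixes p :: nat and q \<mu> A B :: real and f :: "complex \<Rightarrow> complex" and a :: "nat \<Rightarrow> complex"
    and l \<upsilon> :: complex
  assumes "p \<ge> 1" and "0 < q" and "q < 1" and "\<mu> > -1"
    and "-1 \<le> B" and "B < A" and "A \<le> 1"
    and "f \<in> class_S p q \<mu> A B"
    and "has_p_valent_expansion p f a"
    and "\<upsilon> = of_real (B - (A - B) * psi q p 1)
      + of_real (Lambda q \<mu> (p + 2) * (psi q p 1)\<^sup>2 / ((Lambda q \<mu> (p + 1))\<^sup>2 * psi q p 2) * (A - B)) * l"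
  shows "norm (a (p + 2) - l * (a (p + 1))\<^sup>2)
           \<le> (A - B) * psi q p 2 / Lambda q \<mu> (p + 2) * max 1 (norm \<upsilon>)"
proof -
  obtain w where w: "w holomorphic_on ball 0 1" "w 0 = 0" "\<And>z. norm z < 1 \<Longrightarrow> norm (w z) < 1"
    and rel: "\<And>z. norm z < 1 \<Longrightarrow> (1 + of_real B * w z) *
        ((L_op q \<mu> p f z - L_op q \<mu> p f (of_real q * z)) / (1 - of_real q))
      = (1 + of_real A * w z) * (of_real (q_number q (real p)) * L_op q \<mu> p f z)"
    using class_S_schwarz_function[OF assms(5,6,7,1,8)] by blast
  define W where "W = fps_expansion w 0"
  have W: "w has_fps_expansion W"
    unfolding W_def by (rule has_fps_expansion_fps_expansion[OF _ _ w(1)]) auto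
  have W0: "fps_nth W 0 = 0"
    using fps_nth_fps_expansion[OF W, of 0] w(2) by simp
  define P where "P = Abs_fps (\<lambda>n. if n = 0 then 1 else of_real (Lambda q \<mu> (n + p)) * a (n + p))"
  define s :: "nat \<Rightarrow> complex" where "s = (\<lambda>n. if n = 0 then 0 else of_real (1 / psi q p n))"
  define Q where "Q = Abs_fps (\<lambda>n. (1 + s n) * fps_nth P n)"
  let ?Np = "fps_const (of_real (q_number q (real p))) :: complex fps"
  have F: "L_op q \<mu> p f has_fps_expansion fps_X ^ p * P"
    unfolding P_def using assms by (intro L_op_has_fps_expansion)
  \<comment> \<open>The common factor \<open>[p,q] z\<^sup>p\<close> is split off on both sides, so that it can be cancelled.\<close>
  have "Abs_fps (\<lambda>n. of_real (q_number q (real n)) * fps_nth (fps_X ^ p * P) n) = fps_X ^ p * (?Np * Q)"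
  proof (rule fps_ext)
    fix n
    show "fps_nth (Abs_fps (\<lambda>n. of_real (q_number q (real n)) * fps_nth (fps_X ^ p * P) n)) n
        = fps_nth (fps_X ^ p * (?Np * Q)) n"
    proof (cases "n \<le> p")
      case True
      thus ?thesis by (cases "n = p") (simp_all add: fps_X_power_mult_nth Q_def s_def)
    next
      case False
      then obtain k where "n = k + p" "1 \<le> k"
        by (metis add.commute le_add_diff_inverse less_imp_le not_le zero_less_diff less_eq_Suc_le One_nat_def)
      thus ?thesis
        using q_number_ratio[OF assms(2,3,1), of k]
        by (simp add: fps_X_power_mult_nth Q_def s_def)
    qed
  qed
  hence G: "(\<lambda>z. (L_op q \<mu> p f z - L_op q \<mu> p f (of_real q * z)) / (1 - of_real q))
      has_fps_expansion fps_X ^ p * (?Np * Q)"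
    using q_difference_has_fps_expansion[OF F assms(2)] by simp
  let ?l = "\<lambda>z. (1 + of_real B * w z) *
    ((L_op q \<mu> p f z - L_op q \<mu> p f (of_real q * z)) / (1 - of_real q))"
  let ?r = "\<lambda>z. (1 + of_real A * w z) * (of_real (q_number q (real p)) * L_op q \<mu> p f z)"
  have "?l has_fps_expansion (1 + fps_const (of_real B) * W) * (fps_X ^ p * (?Np * Q))"
    by (intro has_fps_expansion_mult has_fps_expansion_add has_fps_expansion_1
        has_fps_expansion_cmult_left W G)
  moreover have "?r has_fps_expansion (1 + fps_const (of_real A) * W) * (?Np * (fps_X ^ p * P))"
    by (intro has_fps_expansion_mult has_fps_expansion_add has_fps_expansion_1
        has_fps_expansion_cmult_left W F)
  moreover have "eventually (\<lambda>z. ?l z = ?r z) (nhds 0)"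
    using rel by (intro eventually_nhds_ball[of 1]) auto
  ultimately have "(1 + fps_const (of_real B) * W) * (fps_X ^ p * (?Np * Q))
      = (1 + fps_const (of_real A) * W) * (?Np * (fps_X ^ p * P))"
    by (rule fps_eq_if_eventually_eq)
  hence eq: "(1 + fps_const (of_real A) * W) * P = (1 + fps_const (of_real B) * W) * Q"
    using q_number_pos[OF assms(2,3), of "real p"] assms(1) by (auto simp: mult_ac)
  note coeffs = subordination_coefficients[OF eq W0, of s]
  define w1 where "w1 = fps_nth W 1"
  define w2 where "w2 = fps_nth W 2"
  define L1 where "L1 = Lambda q \<mu> (p + 1)"
  define L2 where "L2 = Lambda q \<mu> (p + 2)"
  define y1 where "y1 = psi q p 1"
  define y2 where "y2 = psi q p 2"
  have pos: "0 < L1" "0 < L2" "0 < y1" "0 < y2"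
    using assms by (auto simp: L1_def L2_def y1_def y2_def intro!: Lambda_pos psi_pos)
  have a1: "of_real L1 * a (p + 1) = of_real ((A - B) * y1) * w1"
    using coeffs(1) pos
    by (simp add: P_def Q_def s_def L1_def y1_def w1_def field_simps)
  have "of_real (1 / y2) * (of_real L2 * a (p + 2)) = of_real (A - B) * w2
      + of_real (A - B - B / y1) * w1 * (of_real L1 * a (p + 1))"
    using coeffs(2)
    by (simp add: P_def Q_def s_def L1_def L2_def y1_def y2_def w1_def w2_def add.commute)
  also have "\<dots> = of_real (A - B) * w2 + of_real ((A - B - B / y1) * ((A - B) * y1)) * w1\<^sup>2"
    unfolding a1 by (simp add: power2_eq_square)
  \<comment> \<open>\<open>B / y1\<close> comes from the product \<open>B w z \<partial>\<^sub>q F\<close>; the factor \<open>y1\<close> of \<open>b\<^sub>1\<close> clears it.\<close>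
  also have "(A - B - B / y1) * ((A - B) * y1) = - ((A - B) * (B - (A - B) * y1))"
    using pos by (simp add: field_simps)
  finally have "of_real (1 / y2) * (of_real L2 * a (p + 2))
      = of_real (A - B) * (w2 - of_real (B - (A - B) * y1) * w1\<^sup>2)"
    by (simp add: algebra_simps)
  hence a2: "of_real L2 * a (p + 2) = of_real ((A - B) * y2) * (w2 - of_real (B - (A - B) * y1) * w1\<^sup>2)"
    using pos by (simp add: divide_eq_eq mult_ac)
  have a1': "a (p + 1) = of_real ((A - B) * y1 / L1) * w1"
    using a1 pos by (simp add: field_simps)
  have a2': "a (p + 2) = of_real ((A - B) * y2 / L2) * (w2 - of_real (B - (A - B) * y1) * w1\<^sup>2)"
    using a2 pos by (simp add: field_simps)
  have "a (p + 2) - l * (a (p + 1))\<^sup>2 = of_real ((A - B) * y2 / L2) * (w2 - \<upsilon> * w1\<^sup>2)"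
    unfolding a1' a2' assms(10) L1_def[symmetric] L2_def[symmetric] y1_def[symmetric] y2_def[symmetric]
    using pos by (simp add: field_simps power2_eq_square)
  hence "norm (a (p + 2) - l * (a (p + 1))\<^sup>2) = (A - B) * y2 / L2 * norm (w2 - \<upsilon> * w1\<^sup>2)"
    using pos assms(6) by (simp add: norm_mult del: of_real_mult of_real_divide of_real_diff)
  also have "\<dots> \<le> (A - B) * y2 / L2 * max 1 (norm \<upsilon>)"
    unfolding w1_def w2_def using pos assms(6)
    by (intro mult_left_mono norm_convex_le_max schwarz_function_coeff_2[OF w W]) auto
  finally show ?thesis
    by (simp add: L2_def y2_def)
qed

end
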